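(* Regard each $U(\mathfrak{sl}_2)$-module as an $\mathcal H$-module by pulling back via $\natural:\mathcal H\to U(\mathfrak{sl}_2)$. Then: (i) The $\mathcal H$-module $L_0$ is irreducible. (ii) For any integer $n\geq 1$ the $\mathcal H$-module $L_n$ is a direct sum of two non-isomorphic irreducible $\mathcal H$-modules.
   Context: All algebras are unital associative algebras over $\mathbb C$, algebra homomorphisms are unital, and $[x,y]=xy-yx$. $U(\mathfrak{sl}_2)$ is the algebra over $\mathbb C$ generated by $E,F,H$ subject to $[H,E]=2E$, $[H,F]=-2F$, $[E,F]=H$. Its Casimir element is $\Lambda=EF+FE+\frac{H^2}{2}$ (central). The universal Hahn algebra $\mathcal H$ is the algebra over $\mathbb C$ generated by $A,B,C$ with the relations asserting that $[A,B]=C$ and that each of $\alpha=[C,A]+2A^2+B$ and $\beta=[B,C]+4BA+2C$ is central in $\mathcal H$. $\natural:\mathcal H\to U(\mathfrak{sl}_2)$ is the (well-defined) algebra homomorphism with $A\mapsto \frac{H}{4}$, $B\mapsto \frac{E^2+F^2+\Lambda-1}{4}-\frac{H^2}{8}$, $C\mapsto \frac{E^2-F^2}{4}$. For each integer $n\ge 0$, $L_n$ is the $(n+1)$-dimensional irreducible $U(\mathfrak{sl}_2)$-module with basis $\{v_i\}_{i=0}^n$ such that $Ev_i=(n-i+1)v_{i-1}$ $(1\le i\le n)$, $Ev_0=0$; $Fv_i=(i+1)v_{i+1}$ $(0\le i\le n-1)$, $Fv_n=0$; $Hv_i=(n-2i)v_i$ $(0\le i\le n)$. *)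

theory Defs
  imports Complex_Main "HOL-Library.Poly_Mapping"
begin

section \<open>Unital associative algebras over the complex numbers\<close>

class complex_alg = ring_1 +
  fixes cscale :: "complex \<Rightarrow> 'a \<Rightarrow> 'a"  (infixr "*\<^sub>C" 75)
  assumes cscale_add_right: "c *\<^sub>C (x + y) = c *\<^sub>C x + c *\<^sub>C y"
    and cscale_add_left: "(c + d) *\<^sub>C x = c *\<^sub>C x + d *\<^sub>C x"
    and cscale_assoc: "c *\<^sub>C (d *\<^sub>C x) = (c * d) *\<^sub>C x"
    and cscale_one: "1 *\<^sub>C x = x"
    and cscale_mult_left: "(c *\<^sub>C x) * y = c *\<^sub>C (x * y)"
    and cscale_mult_right: "x * (c *\<^sub>C y) = c *\<^sub>C (x * y)"

definition alg_hom :: "('a::complex_alg \<Rightarrow> 'b::complex_alg) \<Rightarrow> bool" where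
  "alg_hom f \<longleftrightarrow> f 1 = 1 \<and> (\<forall>x y. f (x + y) = f x + f y) \<and>
     (\<forall>x y. f (x * y) = f x * f y) \<and> (\<forall>c x. f (c *\<^sub>C x) = c *\<^sub>C f x)"

definition commutator :: "'a::ring \<Rightarrow> 'a \<Rightarrow> 'a" where
  "commutator x y = x * y - y * x"


section \<open>Algebras given by generators and relations\<close>

text \<open>
  Lists under concatenation are the free monoid, so that \<open>'g list \<Rightarrow>\<^sub>0 complex\<close> with the
  convolution product of \<open>Poly_Mapping\<close> is the free algebra on \<open>'g\<close>. Its scalar
  multiplication is multiplication by \<open>single 0 c\<close>.
\<close>

instantiation list :: (type) monoid_add
begin
definition zero_list :: "'a list" where "zero_list = []"
definition plus_list :: "'a list \<Rightarrow> 'a list \<Rightarrow> 'a list" where "plus_list = (@)"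
instance by standard (auto simp: zero_list_def plus_list_def)
end

type_synonym 'g free_alg = "'g list \<Rightarrow>\<^sub>0 complex"

definition free_gen :: "'g \<Rightarrow> 'g free_alg" where
  "free_gen g = Poly_Mapping.single [g] 1"

inductive_set two_sided_ideal :: "'a::ring_1 set \<Rightarrow> 'a set" for R where
  zero: "0 \<in> two_sided_ideal R"
| base: "r \<in> R \<Longrightarrow> a * r * b \<in> two_sided_ideal R"
| add: "x \<in> two_sided_ideal R \<Longrightarrow> y \<in> two_sided_ideal R \<Longrightarrow> x + y \<in> two_sided_ideal R"

lemma two_sided_ideal_mult:
  assumes "x \<in> two_sided_ideal R"
  shows "a * x * b \<in> two_sided_ideal R"
  using assms
proof induction
  case zero
  then show ?case by (simp add: two_sided_ideal.zero)
next
  case (base r a' b')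
  have "a * (a' * r * b') * b = (a * a') * r * (b' * b)" by (simp add: mult.assoc)
  then show ?case using two_sided_ideal.base[OF base] by metis
next
  case (add x y)
  then show ?case by (simp add: distrib_left distrib_right two_sided_ideal.add)
qed

lemma two_sided_ideal_uminus: "x \<in> two_sided_ideal R \<Longrightarrow> - x \<in> two_sided_ideal R"
  using two_sided_ideal_mult[of x R "-1" 1] by simp

lemma free_alg_induct [case_names zero add]:
  assumes "P 0" "\<And>w c p. P p \<Longrightarrow> P (Poly_Mapping.single w c + p)"
  shows "P (p :: 'g free_alg)"
proof (induction p rule: update_induct)
  case const
  then show ?case by (rule assms)
next
  case (update f a b)
  have "Poly_Mapping.update a b f = Poly_Mapping.single a b + f"
    using update(1)
    by (intro poly_mapping_eqI)
       (auto simp: lookup_update lookup_add lookup_single in_keys_iff when_def)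
  then show ?case using assms(2) update(3) by metis
qed

lemma single_zero_commute:
  "x * Poly_Mapping.single 0 c = Poly_Mapping.single 0 c * (x :: 'g free_alg)"
proof (induction x rule: free_alg_induct)
  case zero
  then show ?case by simp
next
  case (add a b f)
  then show ?case
    by (simp add: distrib_left distrib_right mult_single mult.commute)
qed

text \<open>
  The algebra homomorphism from the free algebra that extends \<open>f\<close>.
\<close>

definition free_eval :: "('g \<Rightarrow> 'a::complex_alg) \<Rightarrow> 'g free_alg \<Rightarrow> 'a" where
  "free_eval f p = (\<Sum>w\<in>Poly_Mapping.keys p. Poly_Mapping.lookup p w *\<^sub>C prod_list (map f w))"

lemma cscale_zero_left [simp]: "0 *\<^sub>C x = (0::'a::complex_alg)"
  using cscale_add_left[of 0 0 x] by simp

lemma cscale_zero_right [simp]: "c *\<^sub>C 0 = (0::'a::complex_alg)"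
  using cscale_add_right[of c 0 0] by simp

lemma cscale_minus_right: "c *\<^sub>C (- x) = - (c *\<^sub>C (x::'a::complex_alg))"
  using cscale_add_right[of c x "- x"] by (simp add: eq_neg_iff_add_eq_0 add.commute)

lemma cscale_minus_left: "(- c) *\<^sub>C x = - (c *\<^sub>C (x::'a::complex_alg))"
  using cscale_add_left[of c "- c" x] by (simp add: eq_neg_iff_add_eq_0 add.commute)

lemma cscale_diff_right: "c *\<^sub>C (x - y) = c *\<^sub>C x - c *\<^sub>C (y::'a::complex_alg)"
  using cscale_add_right[of c x "- y"] by (simp add: cscale_minus_right)

lemma free_eval_superset:
  assumes "finite K" "Poly_Mapping.keys p \<subseteq> K"
  shows "free_eval f p = (\<Sum>w\<in>K. Poly_Mapping.lookup p w *\<^sub>C prod_list (map f w))"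
  unfolding free_eval_def
  by (rule sum.mono_neutral_left) (use assms in \<open>auto simp: in_keys_iff\<close>)

lemma free_eval_add: "free_eval f (p + q) = free_eval f p + free_eval f q"
proof -
  let ?K = "Poly_Mapping.keys p \<union> Poly_Mapping.keys q"
  have "Poly_Mapping.keys (p + q) \<subseteq> ?K" by (rule Poly_Mapping.keys_add)
  then show ?thesis
    by (simp add: free_eval_superset[of ?K] lookup_add cscale_add_left sum.distrib)
qed

lemma free_eval_zero [simp]: "free_eval f 0 = 0"
  by (simp add: free_eval_def)

lemma free_eval_uminus: "free_eval f (- p) = - free_eval f p"
  using free_eval_add[of f p "- p"] by (simp add: eq_neg_iff_add_eq_0 add.commute)

lemma free_eval_diff: "free_eval f (p - q) = free_eval f p - free_eval f q"
  using free_eval_add[of f p "- q"] by (simp add: free_eval_uminus)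

lemma free_eval_single: "free_eval f (Poly_Mapping.single w c) = c *\<^sub>C prod_list (map f w)"
  by (cases "c = 0") (simp_all add: free_eval_def)

lemma free_eval_gen [simp]: "free_eval f (free_gen g) = f g"
  by (simp add: free_gen_def free_eval_single cscale_one)

lemma free_eval_one [simp]: "free_eval f 1 = 1"
  using free_eval_single[of f 0 1] by (simp del: single_one add: cscale_one zero_list_def flip: single_one)

lemma free_eval_mult: "free_eval f (p * q) = free_eval f p * free_eval f q"
proof (induction p rule: free_alg_induct)
  case (add v c p)
  have "free_eval f (Poly_Mapping.single v c * q) =
      c *\<^sub>C prod_list (map f v) * free_eval f q"
  proof (induction q rule: free_alg_induct)
    case (add w d q)
    then show ?case
      by (simp add: distrib_left free_eval_add mult_single free_eval_single plus_list_def
        cscale_mult_left cscale_mult_right cscale_assoc mult.commute[of c])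
  qed simp
  then show ?case using add
    by (simp add: distrib_right free_eval_add free_eval_single)
qed simp

lemma free_eval_scale: "free_eval f (Poly_Mapping.single 0 c * p) = c *\<^sub>C free_eval f p"
  by (simp add: free_eval_mult free_eval_single zero_list_def cscale_mult_left)

lemma free_eval_numeral [simp]: "free_eval f (numeral n) = numeral n"
  by (induction n) (simp_all only: numeral.simps free_eval_add free_eval_one)

lemma free_eval_ideal:
  assumes "\<And>r. r \<in> R \<Longrightarrow> free_eval f r = 0" "x \<in> two_sided_ideal R"
  shows "free_eval f x = 0"
  using assms(2) by induction (auto simp: free_eval_add free_eval_mult assms(1))

lemma one_notin_two_sided_ideal:
  fixes f :: "'g \<Rightarrow> 'a::complex_alg"
  assumes "\<And>r. r \<in> R \<Longrightarrow> free_eval f r = 0"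
  shows "1 \<notin> two_sided_ideal R"
  using free_eval_ideal[of R f 1] assms by auto

lemma commutes_free_eval:
  assumes "\<And>g. z * f g = f g * z"
  shows "z * free_eval f p = free_eval f p * z"
proof (induction p rule: free_alg_induct)
  case (add w c p)
  have "z * prod_list (map f w) = prod_list (map f w) * z"
    by (induction w) (simp_all, metis assms mult.assoc)
  then show ?case using add
    by (simp add: free_eval_add free_eval_single distrib_left distrib_right
      cscale_mult_left cscale_mult_right)
qed simp

text \<open>
  A presentation is attached to its type of generators; \<open>'g palg\<close> is then the algebra
  generated by \<open>'g\<close> subject to \<open>r = 0\<close> for each \<open>r\<close> in \<open>relators\<close>.
  The class assumption says that this algebra is nonzero, as \<open>ring_1\<close> demands.
\<close>

class presentation =
  fixes relators :: "('a list \<Rightarrow>\<^sub>0 complex) set"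
  assumes one_notin_relators: "1 \<notin> two_sided_ideal relators"

definition palg_eq :: "'g::presentation free_alg \<Rightarrow> 'g free_alg \<Rightarrow> bool" where
  "palg_eq x y \<longleftrightarrow> x - y \<in> two_sided_ideal relators"

quotient_type (overloaded) 'g palg = "('g::presentation) free_alg" / palg_eq
proof (rule equivpI)
  show "reflp palg_eq"
    by (auto simp: reflp_def palg_eq_def intro: two_sided_ideal.zero)
  show "symp palg_eq"
    by (rule sympI, unfold palg_eq_def, drule two_sided_ideal_uminus) simp
  show "transp palg_eq"
    by (rule transpI, unfold palg_eq_def, drule (1) two_sided_ideal.add) simp
qed

instantiation palg :: (presentation) complex_alg
begin

lift_definition zero_palg :: "'a palg" is 0 .
lift_definition one_palg :: "'a palg" is 1 .
lift_definition plus_palg :: "'a palg \<Rightarrow> 'a palg \<Rightarrow> 'a palg" is "(+)"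
  unfolding palg_eq_def by (drule (1) two_sided_ideal.add) (simp add: algebra_simps)
lift_definition uminus_palg :: "'a palg \<Rightarrow> 'a palg" is uminus
  unfolding palg_eq_def by (drule two_sided_ideal_uminus) (simp add: algebra_simps)
lift_definition minus_palg :: "'a palg \<Rightarrow> 'a palg \<Rightarrow> 'a palg" is "(-)"
proof -
  fix a b c d :: "'a free_alg"
  assume "palg_eq a b" "palg_eq c d"
  then have "(a - b) + - (c - d) \<in> two_sided_ideal relators"
    unfolding palg_eq_def by (intro two_sided_ideal.add two_sided_ideal_uminus)
  then show "palg_eq (a - c) (b - d)"
    unfolding palg_eq_def by (simp add: algebra_simps)
qed
lift_definition times_palg :: "'a palg \<Rightarrow> 'a palg \<Rightarrow> 'a palg" is "(*)"
proof -
  fix a b c d :: "'a free_alg"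
  assume "palg_eq a b" "palg_eq c d"
  then have "1 * (a - b) * c + b * (c - d) * 1 \<in> two_sided_ideal relators"
    unfolding palg_eq_def by (intro two_sided_ideal.add two_sided_ideal_mult)
  then show "palg_eq (a * c) (b * d)"
    unfolding palg_eq_def by (simp add: algebra_simps)
qed
lift_definition cscale_palg :: "complex \<Rightarrow> 'a palg \<Rightarrow> 'a palg"
  is "\<lambda>c x. Poly_Mapping.single 0 c * x"
proof -
  fix c :: complex and a b :: "'a free_alg"
  assume "palg_eq a b"
  then show "palg_eq (Poly_Mapping.single 0 c * a) (Poly_Mapping.single 0 c * b)"
    using two_sided_ideal_mult[of "a - b" relators "Poly_Mapping.single 0 c" 1]
    unfolding palg_eq_def by (simp add: algebra_simps)
qed

lemma palg_eq_refl: "x = y \<Longrightarrow> palg_eq x y"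
  by (simp add: palg_eq_def two_sided_ideal.zero)

instance
proof
  fix a b c :: "'a palg" and s t :: complex
  show "a * b * c = a * (b * c)" by transfer (simp add: palg_eq_refl mult.assoc)
  show "1 * a = a" by transfer (simp add: palg_eq_refl)
  show "a * 1 = a" by transfer (simp add: palg_eq_refl)
  show "(a + b) * c = a * c + b * c" by transfer (simp add: palg_eq_refl distrib_right)
  show "a * (b + c) = a * b + a * c" by transfer (simp add: palg_eq_refl distrib_left)
  show "a + b + c = a + (b + c)" by transfer (simp add: palg_eq_refl add.assoc)
  show "a + b = b + a" by transfer (simp add: palg_eq_refl add.commute)
  show "0 + a = a" by transfer (simp add: palg_eq_refl)
  show "- a + a = 0" by transfer (simp add: palg_eq_refl)
  show "a - b = a + - b" by transfer (simp add: palg_eq_refl)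
  show "s *\<^sub>C (a + b) = s *\<^sub>C a + s *\<^sub>C b"
    by transfer (simp add: palg_eq_refl distrib_left)
  show "(s + t) *\<^sub>C a = s *\<^sub>C a + t *\<^sub>C a"
    by transfer (simp add: palg_eq_refl distrib_right single_add)
  show "s *\<^sub>C (t *\<^sub>C a) = (s * t) *\<^sub>C a"
    by transfer (simp add: palg_eq_refl mult_single flip: mult.assoc)
  show "1 *\<^sub>C a = a" by transfer (simp add: palg_eq_refl)
  show "(s *\<^sub>C a) * b = s *\<^sub>C (a * b)"
    by transfer (simp add: palg_eq_refl mult.assoc)
  show "a * (s *\<^sub>C b) = s *\<^sub>C (a * b)"
    by transfer
      (rule palg_eq_refl, simp only: mult.assoc[symmetric] single_zero_commute)
  show "(0::'a palg) \<noteq> 1"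
  proof
    assume "(0::'a palg) = 1"
    then have "palg_eq (0::'a free_alg) 1" by (simp only: zero_palg_def one_palg_def palg.abs_eq_iff)
    then show False
      using two_sided_ideal_uminus[of "- 1 :: 'a free_alg" relators]
        one_notin_relators[where 'a = 'a]
      by (simp add: palg_eq_def)
  qed
qed

end

definition palg_gen :: "'g \<Rightarrow> 'g::presentation palg" where
  "palg_gen g = abs_palg (free_gen g)"

text \<open>
  The universal property: if \<open>f\<close> kills the relators, \<open>palg_lift f\<close> is the algebra
  homomorphism that sends \<open>palg_gen g\<close> to \<open>f g\<close>. Otherwise its value is not meaningful.
\<close>

definition palg_lift :: "('g::presentation \<Rightarrow> 'a::complex_alg) \<Rightarrow> 'g palg \<Rightarrow> 'a" where
  "palg_lift f x = free_eval f (rep_palg x)"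

lemma palg_lift_abs:
  assumes "\<And>r. r \<in> relators \<Longrightarrow> free_eval f r = 0"
  shows "palg_lift f (abs_palg p) = free_eval f p"
proof -
  have "palg_eq (rep_palg (abs_palg p)) p"
    by (rule Quotient3_rep_abs[OF Quotient3_palg]) (simp add: palg_eq_refl)
  then show ?thesis
    using free_eval_ideal[OF assms, of relators "rep_palg (abs_palg p) - p"]
    by (simp add: palg_lift_def palg_eq_def free_eval_diff)
qed

lemma palg_lift_gen:
  assumes "\<And>r. r \<in> relators \<Longrightarrow> free_eval f r = 0"
  shows "palg_lift f (palg_gen g) = f g"
  by (simp add: palg_gen_def palg_lift_abs assms)

lemma alg_hom_palg_lift:
  assumes "\<And>r. r \<in> relators \<Longrightarrow> free_eval f r = 0"
  shows "alg_hom (palg_lift f)"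
proof -
  note lift = palg_lift_abs[of f, OF assms]
  have 1: "palg_lift f 1 = 1"
    by (simp add: one_palg_def lift)
  have 2: "palg_lift f (x + y) = palg_lift f x + palg_lift f y" for x y
    by (induct x rule: palg.abs_induct, induct y rule: palg.abs_induct)
       (simp add: plus_palg.abs_eq lift free_eval_add)
  have 3: "palg_lift f (x * y) = palg_lift f x * palg_lift f y" for x y
    by (induct x rule: palg.abs_induct, induct y rule: palg.abs_induct)
       (simp add: times_palg.abs_eq lift free_eval_mult)
  have 4: "palg_lift f (c *\<^sub>C x) = c *\<^sub>C palg_lift f x" for c x
    by (induct x rule: palg.abs_induct)
       (simp add: cscale_palg.abs_eq lift free_eval_scale)
  show ?thesis using 1 2 3 4 by (simp add: alg_hom_def)
qed

instantiation complex :: complex_alg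
begin
definition cscale_complex :: "complex \<Rightarrow> complex \<Rightarrow> complex" where "cscale_complex = (*)"
instance by standard (auto simp: cscale_complex_def algebra_simps)
end


lemma palg_commutes:
  assumes "\<And>g. z * palg_gen g = palg_gen g * z"
  shows "z * x = x * (z :: 'g::presentation palg)"
proof -
  have abs_add: "abs_palg (p + q) = abs_palg p + abs_palg q" for p q :: "'g free_alg"
    by (simp add: plus_palg.abs_eq)
  have gen: "z * abs_palg (Poly_Mapping.single w c) = abs_palg (Poly_Mapping.single w c) * z" for w c
  proof (induction w)
    case Nil
    have "abs_palg (Poly_Mapping.single [] c) = c *\<^sub>C (1 :: 'g palg)"
      by (simp add: one_palg_def cscale_palg.abs_eq zero_list_def)
    then show ?case by (simp add: cscale_mult_left cscale_mult_right)
  next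
    case (Cons g w)
    have "abs_palg (Poly_Mapping.single (g # w) c) =
        palg_gen g * abs_palg (Poly_Mapping.single w c)"
      by (simp add: palg_gen_def free_gen_def times_palg.abs_eq mult_single plus_list_def)
    then show ?case using Cons assms by (metis mult.assoc)
  qed
  have "z * abs_palg p = abs_palg p * z" for p
  proof (induction p rule: free_alg_induct)
    case zero
    then show ?case by (simp flip: zero_palg_def)
  next
    case (add w c p)
    then show ?case by (simp add: abs_add gen distrib_left distrib_right)
  qed
  then show ?thesis by (induct x rule: palg.abs_induct) simp
qed

lemma free_eval_palg_gen: "free_eval palg_gen p = abs_palg p"
proof (induction p rule: free_alg_induct)
  case zero
  then show ?case by (simp flip: zero_palg_def)
next
  case (add w c p)
  have "abs_palg (Poly_Mapping.single w c) = c *\<^sub>C prod_list (map palg_gen w)"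
  proof (induction w)
    case Nil
    then show ?case by (simp add: one_palg_def cscale_palg.abs_eq zero_list_def)
  next
    case (Cons g w)
    have "abs_palg (Poly_Mapping.single (g # w) c) =
        palg_gen g * abs_palg (Poly_Mapping.single w c)"
      by (simp add: palg_gen_def free_gen_def times_palg.abs_eq mult_single plus_list_def)
    then show ?case using Cons by (simp add: cscale_mult_right)
  qed
  then show ?case using add
    by (simp add: free_eval_add free_eval_single flip: plus_palg.abs_eq)
qed

lemma palg_relation: "r \<in> relators \<Longrightarrow> free_eval palg_gen r = 0"
  using two_sided_ideal.base[of r relators 1 1]
  by (simp add: free_eval_palg_gen zero_palg_def palg.abs_eq_iff palg_eq_def)

lemma free_eval_commutator:
  "free_eval f (commutator x y) = commutator (free_eval f x) (free_eval f y)"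
  by (simp add: commutator_def free_eval_diff free_eval_mult)


lemmas free_eval_simps = free_eval_add free_eval_uminus free_eval_diff free_eval_mult

section \<open>The algebra \<open>U(sl\<^sub>2)\<close> and the universal Hahn algebra\<close>

datatype sl2_gen = E_gen | F_gen | H_gen

instantiation sl2_gen :: presentation
begin

definition relators_sl2_gen :: "sl2_gen free_alg set" where
  "relators_sl2_gen =
     (let E = free_gen E_gen; F = free_gen F_gen; H = free_gen H_gen
      in {commutator H E - 2 * E, commutator H F - (- (2 * F)), commutator E F - H})"

instance
proof
  show "1 \<notin> two_sided_ideal (relators :: sl2_gen free_alg set)"
    by (rule one_notin_two_sided_ideal[where f = "\<lambda>_. 0 :: complex"])
       (auto simp: relators_sl2_gen_def Let_def free_eval_simps commutator_def)
qed

end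

type_synonym usl2 = "sl2_gen palg"

definition U_E :: usl2 where "U_E = palg_gen E_gen"
definition U_F :: usl2 where "U_F = palg_gen F_gen"
definition U_H :: usl2 where "U_H = palg_gen H_gen"

definition casimir :: usl2 where
  "casimir = U_E * U_F + U_F * U_E + (1/2) *\<^sub>C U_H^2"

datatype hahn_gen = A_gen | B_gen | C_gen

definition hahn_alpha :: "'a::ring_1 \<Rightarrow> 'a \<Rightarrow> 'a \<Rightarrow> 'a" where
  "hahn_alpha a b c = commutator c a + 2 * a^2 + b"

definition hahn_beta :: "'a::ring_1 \<Rightarrow> 'a \<Rightarrow> 'a \<Rightarrow> 'a" where
  "hahn_beta a b c = commutator b c + 4 * (b * a) + 2 * c"

lemma free_eval_hahn:
  "free_eval f (hahn_alpha a b c) = hahn_alpha (free_eval f a) (free_eval f b) (free_eval f c)"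
  "free_eval f (hahn_beta a b c) = hahn_beta (free_eval f a) (free_eval f b) (free_eval f c)"
  by (simp_all add: hahn_alpha_def hahn_beta_def free_eval_commutator free_eval_add
      free_eval_mult power2_eq_square)

instantiation hahn_gen :: presentation
begin

definition relators_hahn_gen :: "hahn_gen free_alg set" where
  "relators_hahn_gen =
     (let A = free_gen A_gen; B = free_gen B_gen; C = free_gen C_gen
      in {commutator A B - C}
         \<union> range (commutator (hahn_alpha A B C))
         \<union> range (commutator (hahn_beta A B C)))"

instance
proof
  show "1 \<notin> two_sided_ideal (relators :: hahn_gen free_alg set)"
    by (rule one_notin_two_sided_ideal[where f = "\<lambda>_. 0 :: complex"])
       (auto simp: relators_hahn_gen_def Let_def free_eval_simps commutator_def)
qed

end

type_synonym hahn = "hahn_gen palg"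

definition hahn_A :: hahn where "hahn_A = palg_gen A_gen"
definition hahn_B :: hahn where "hahn_B = palg_gen B_gen"
definition hahn_C :: hahn where "hahn_C = palg_gen C_gen"


section \<open>The homomorphism from the universal Hahn algebra to \<open>U(sl\<^sub>2)\<close>\<close>

primrec natural_gen :: "hahn_gen \<Rightarrow> usl2" where
  "natural_gen A_gen = (1/4) *\<^sub>C U_H"
| "natural_gen B_gen = (1/4) *\<^sub>C (U_E^2 + U_F^2 + casimir - 1) - (1/8) *\<^sub>C U_H^2"
| "natural_gen C_gen = (1/4) *\<^sub>C (U_E^2 - U_F^2)"

definition natural :: "hahn \<Rightarrow> usl2" where
  "natural = palg_lift natural_gen"

lemma cscale_numeral: "numeral n *\<^sub>C x = numeral n * (x::'a::complex_alg)"
  by (induction n) (simp_all only: numeral.simps cscale_add_left cscale_one distrib_right mult_1)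

lemma cscale_cancel_numeral: "(1 / numeral n) *\<^sub>C (numeral n * x) = (x::'a::complex_alg)"
  by (simp add: cscale_assoc cscale_one flip: cscale_numeral)

lemma U_relations:
  "U_H * U_E = U_E * U_H + 2 * U_E"
  "U_H * U_F = U_F * U_H - 2 * U_F"
  "U_F * U_E = U_E * U_F - U_H"
proof -
  have *: "free_eval palg_gen r = (0::usl2)" if "r \<in> relators" for r
    using palg_relation that .
  note simps = relators_sl2_gen_def Let_def free_eval_simps commutator_def
    U_E_def U_F_def U_H_def
  show "U_H * U_E = U_E * U_H + 2 * U_E"
    using *[of "commutator (free_gen H_gen) (free_gen E_gen) - 2 * free_gen E_gen"]
    by (simp add: simps) (simp add: algebra_simps)
  show "U_H * U_F = U_F * U_H - 2 * U_F"
    using *[of "commutator (free_gen H_gen) (free_gen F_gen) - (- (2 * free_gen F_gen))"]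
    by (simp add: simps) (simp add: algebra_simps eq_neg_iff_add_eq_0)
  show "U_F * U_E = U_E * U_F - U_H"
    using *[of "commutator (free_gen E_gen) (free_gen F_gen) - free_gen H_gen"]
    by (simp add: simps) (simp add: algebra_simps)
qed

context
  fixes e f h :: "'a::complex_alg"
  assumes he: "h * e = e * h + 2 * e"
    and hf: "h * f = f * h - 2 * f"
    and fe: "f * e = e * f - h"
begin

lemma sl2_normal:
  "h * e = e * h + e + e" "h * (e * x) = e * (h * x) + e * x + e * x"
  "h * f = f * h - f - f" "h * (f * x) = f * (h * x) - f * x - f * x"
  "f * e = e * f - h" "f * (e * x) = e * (f * x) - h * x"
proof -
  show 1: "h * e = e * h + e + e" and 2: "h * f = f * h - f - f" and 3: "f * e = e * f - h"
    using he hf fe by (simp_all add: mult_2)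
  show "h * (e * x) = e * (h * x) + e * x + e * x"
    using arg_cong[OF 1, of "\<lambda>y. y * x"] by (simp add: algebra_simps)
  show "h * (f * x) = f * (h * x) - f * x - f * x"
    using arg_cong[OF 2, of "\<lambda>y. y * x"] by (simp add: algebra_simps)
  show "f * (e * x) = e * (f * x) - h * x"
    using arg_cong[OF 3, of "\<lambda>y. y * x"] by (simp add: algebra_simps)
qed

lemma double_casimir:
  "2 *\<^sub>C (e * f + f * e + (1/2) *\<^sub>C h^2) = e * f + e * f + f * e + f * e + h * h"
  by (simp add: cscale_add_right cscale_assoc cscale_one power2_eq_square cscale_numeral mult_2)

lemma double_casimir_commutes:
  assumes "x \<in> {e, f, h}"
  shows "(e * f + e * f + f * e + f * e + h * h) * x =
         x * (e * f + e * f + f * e + f * e + h * h)"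
  using assms by (auto simp: sl2_normal algebra_simps)

lemma casimir_commutes:
  assumes "x \<in> {e, f, h}"
  shows "(e * f + f * e + (1/2) *\<^sub>C h^2) * x = x * (e * f + f * e + (1/2) *\<^sub>C h^2)"
    (is "?l * x = x * ?l")
proof -
  have "2 *\<^sub>C (?l * x) = (2 *\<^sub>C ?l) * x" by (simp only: cscale_mult_left)
  also have "\<dots> = x * (2 *\<^sub>C ?l)"
    using double_casimir_commutes[OF assms] by (simp only: double_casimir)
  also have "\<dots> = 2 *\<^sub>C (x * ?l)" by (simp only: cscale_mult_right)
  finally have "(1/2) *\<^sub>C (2 *\<^sub>C (?l * x)) = (1/2) *\<^sub>C (2 *\<^sub>C (x * ?l))" by simp
  then show ?thesis by (simp add: cscale_assoc cscale_one)
qed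

lemma commutator_simps:
  fixes x y z :: 'a
  shows "commutator (x + y) z = commutator x z + commutator y z"
    "commutator (x - y) z = commutator x z - commutator y z"
    "commutator x (y + z) = commutator x y + commutator x z"
    "commutator x (y - z) = commutator x y - commutator x z"
    "commutator (s *\<^sub>C x) y = s *\<^sub>C commutator x y"
    "commutator x (s *\<^sub>C y) = s *\<^sub>C commutator x y"
    "commutator x x = 0" "commutator x 1 = 0" "commutator 1 x = 0"
  by (simp_all add: commutator_def algebra_simps cscale_mult_left cscale_mult_right
      cscale_diff_right)

lemma cscale_half:
  "(1/2) *\<^sub>C x = (1/4) *\<^sub>C x + (1/4) *\<^sub>C (x::'a)"
  "(1/4) *\<^sub>C x = (1/8) *\<^sub>C x + (1/8) *\<^sub>C (x::'a)"
  by (simp_all flip: cscale_add_left)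

lemma natural_identities:
  defines "l \<equiv> e * f + f * e + (1/2) *\<^sub>C h^2"
  defines "a \<equiv> (1/4) *\<^sub>C h"
    and "b \<equiv> (1/4) *\<^sub>C (e^2 + f^2 + l - 1) - (1/8) *\<^sub>C h^2"
    and "c \<equiv> (1/4) *\<^sub>C (e^2 - f^2)"
  shows "commutator a b = c" "hahn_alpha a b c = (1/4) *\<^sub>C (l - 1)" "hahn_beta a b c = 0"
proof -
  define X where "X = e * e"
  define Y where "Y = f * f"
  have sq: "e^2 = X" "f^2 = Y" by (simp_all add: X_def Y_def power2_eq_square)
  have l_comm: "x * l = l * x" if "x \<in> {e, f, h}" for x
    using casimir_commutes[OF that] by (simp add: l_def)
  have l_XY: "X * l = l * X" "Y * l = l * Y"
    using l_comm[of e] l_comm[of f] by (simp_all add: X_def Y_def) (metis mult.assoc)+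
  have l0: "commutator h l = 0" "commutator l X = 0" "commutator l Y = 0"
    using l_comm[of h] l_XY by (simp_all add: commutator_def)
  have hX: "h * X = X * h + (X + X + X + X)" and hY: "h * Y = Y * h - (Y + Y + Y + Y)"
    by (simp_all add: X_def Y_def sl2_normal algebra_simps)
  have hX': "h * (X * z) = X * (h * z) + (X * z + X * z + X * z + X * z)"
    and hY': "h * (Y * z) = Y * (h * z) - (Y * z + Y * z + Y * z + Y * z)" for z
    using arg_cong[OF hX, of "\<lambda>y. y * z"] arg_cong[OF hY, of "\<lambda>y. y * z"]
    by (simp_all add: algebra_simps)
  have four: "x + x + x + x = 4 *\<^sub>C x" for x :: 'a
  proof -
    have "x + x + x + x = (1 + 1 + 1 + 1) *\<^sub>C x"
      by (simp only: cscale_add_left cscale_one)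
    then show ?thesis by simp
  qed
  have two: "2 *\<^sub>C x = x + x" for x :: 'a
    by (simp add: cscale_numeral mult_2)
  have chX: "commutator h X = 4 *\<^sub>C X" and chY: "commutator h Y = - (4 *\<^sub>C Y)"
    and cXh: "commutator X h = - (4 *\<^sub>C X)" and cYh: "commutator Y h = 4 *\<^sub>C Y"
    by (simp_all add: commutator_def hX hY four)
  have ch: "commutator h (h^2) = 0"
    by (simp add: commutator_def power2_eq_square mult.assoc)
  show "commutator a b = c"
    by (simp add: a_def b_def c_def sq commutator_simps chX chY l0 ch
        cscale_assoc cscale_diff_right cscale_minus_right)
  show "hahn_alpha a b c = (1/4) *\<^sub>C (l - 1)"
    by (simp add: hahn_alpha_def a_def b_def c_def sq commutator_simps cXh cYh
        cscale_assoc cscale_diff_right cscale_add_right cscale_minus_right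
        cscale_mult_left cscale_mult_right
        power2_eq_square[of h] power2_eq_square[of "(1/4) *\<^sub>C h"] flip: cscale_numeral[where 'a = 'a])
  have cXY: "commutator X Y = 4 *\<^sub>C (e * (f * h)) - 2 *\<^sub>C (h * h) - 2 *\<^sub>C h"
        by (simp add: commutator_def X_def Y_def sl2_normal algebra_simps two
        flip: four)
  have cYX: "commutator Y X = - commutator X Y"
    by (simp add: commutator_def)
  have chhX: "commutator (h^2) X = 8 *\<^sub>C (X * h) + 16 *\<^sub>C X"
    and chhY: "commutator (h^2) Y = - (8 *\<^sub>C (Y * h)) + 16 *\<^sub>C Y"
  proof -
    have "h * h * X = X * (h * h) + 4 *\<^sub>C (X * h) + 4 *\<^sub>C (X * h) + 4 *\<^sub>C (4 *\<^sub>C X)"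
      using hX[unfolded four] hX'[of h, unfolded four]
      by (simp add: mult.assoc distrib_left distrib_right cscale_mult_left cscale_mult_right
          cscale_add_right add.assoc)
    then show "commutator (h^2) X = 8 *\<^sub>C (X * h) + 16 *\<^sub>C X"
      by (simp add: commutator_def power2_eq_square cscale_assoc flip: cscale_add_left)
    have "h * h * Y = Y * (h * h) - 4 *\<^sub>C (Y * h) - 4 *\<^sub>C (Y * h) + 4 *\<^sub>C (4 *\<^sub>C Y)"
      using hY[unfolded four] hY'[of h, unfolded four]
      by (simp add: mult.assoc left_diff_distrib right_diff_distrib cscale_mult_left
          cscale_mult_right cscale_diff_right)
    moreover have "4 *\<^sub>C (Y * h) + 4 *\<^sub>C (Y * h) = 8 *\<^sub>C (Y * h)"
      by (simp flip: cscale_add_left)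
    ultimately show "commutator (h^2) Y = - (8 *\<^sub>C (Y * h)) + 16 *\<^sub>C Y"
      by (simp add: commutator_def power2_eq_square cscale_assoc algebra_simps)
  qed
  have lh: "(1/4) *\<^sub>C (l * h) = (1/8) *\<^sub>C (4 *\<^sub>C (e * (f * h)) - 2 *\<^sub>C (h * h) + h * (h * h))"
  proof -
    have "(2 *\<^sub>C l) * h = 4 *\<^sub>C (e * (f * h)) - 2 *\<^sub>C (h * h) + h * (h * h)"
      unfolding l_def double_casimir
      by (simp add: sl2_normal algebra_simps two flip: four)
    moreover have "(1/4) *\<^sub>C (l * h) = (1/8) *\<^sub>C ((2 *\<^sub>C l) * h)"
      by (simp add: cscale_mult_left cscale_assoc)
    ultimately show ?thesis by simp
  qed
  have cbc: "commutator b c = - ((1/8) *\<^sub>C commutator X Y)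
      - ((1/4) *\<^sub>C (X * h) + (1/4) *\<^sub>C (Y * h) + (1/2) *\<^sub>C X - (1/2) *\<^sub>C Y)"
  proof -
    have "commutator b c = - ((1/16) *\<^sub>C commutator X Y + (1/16) *\<^sub>C commutator X Y)
      - ((1/4) *\<^sub>C (X * h) + (1/4) *\<^sub>C (Y * h) + (1/2) *\<^sub>C X - (1/2) *\<^sub>C Y)"
      by (simp add: b_def c_def sq commutator_simps l0 chhX chhY cYX cscale_assoc
          cscale_diff_right cscale_add_right cscale_minus_right)
    then show ?thesis by (simp flip: cscale_add_left)
  qed
  have ba: "4 * (b * a) = (1/4) *\<^sub>C (X * h) + (1/4) *\<^sub>C (Y * h) + (1/4) *\<^sub>C (l * h)
      - (1/4) *\<^sub>C h - (1/8) *\<^sub>C (h * (h * h))"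
    by (simp add: b_def a_def sq power2_eq_square[of h] distrib_right left_diff_distrib mult.assoc
        cscale_mult_left cscale_mult_right cscale_assoc cscale_diff_right cscale_add_right
        flip: cscale_numeral[where 'a = 'a])
  have c2: "2 * c = (1/2) *\<^sub>C X - (1/2) *\<^sub>C Y"
    by (simp add: c_def sq cscale_assoc cscale_diff_right flip: cscale_numeral[where 'a = 'a])
  show "hahn_beta a b c = 0"
    by (simp add: hahn_beta_def cbc ba c2 cXY lh cscale_assoc cscale_diff_right cscale_add_right)
qed

end

lemma natural_gen_relators:
  assumes "r \<in> relators"
  shows "free_eval natural_gen r = 0"
proof -
  note ids = natural_identities[OF U_relations, folded casimir_def]
  note central = casimir_commutes[OF U_relations, folded casimir_def]
  have "casimir * palg_gen g = palg_gen g * casimir" for g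
    using central by (cases g) (simp_all flip: U_E_def U_F_def U_H_def)
  then have "casimir * x = x * casimir" for x
    by (rule palg_commutes)
  then have "commutator ((1/4) *\<^sub>C (casimir - 1)) x = 0" for x
    by (simp add: commutator_def cscale_mult_left cscale_mult_right algebra_simps)
  then show ?thesis
    using assms ids
    by (auto simp: relators_hahn_gen_def Let_def free_eval_commutator free_eval_diff
        free_eval_hahn) (simp add: commutator_def)
qed

lemma alg_hom_natural: "alg_hom natural"
  unfolding natural_def by (rule alg_hom_palg_lift) (rule natural_gen_relators)

lemma natural_hahn:
  "natural hahn_A = (1/4) *\<^sub>C U_H"
  "natural hahn_B = (1/4) *\<^sub>C (U_E^2 + U_F^2 + casimir - 1) - (1/8) *\<^sub>C U_H^2"
  "natural hahn_C = (1/4) *\<^sub>C (U_E^2 - U_F^2)"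
  by (simp_all add: natural_def hahn_A_def hahn_B_def hahn_C_def palg_lift_gen
      natural_gen_relators)


section \<open>Modules\<close>

text \<open>
  A left module over a unital complex algebra is a left module over its underlying unital
  ring; its complex vector space structure is given by the action of \<open>c *\<^sub>C 1\<close>.
\<close>

locale alg_module =
  fixes act :: "'r::complex_alg \<Rightarrow> 'v::ab_group_add \<Rightarrow> 'v" and V :: "'v set"
  assumes zero_closed: "0 \<in> V"
    and add_closed: "u \<in> V \<Longrightarrow> v \<in> V \<Longrightarrow> u + v \<in> V"
    and act_closed: "v \<in> V \<Longrightarrow> act x v \<in> V"
    and act_add_right: "u \<in> V \<Longrightarrow> v \<in> V \<Longrightarrow> act x (u + v) = act x u + act x v"
    and act_add_left: "v \<in> V \<Longrightarrow> act (x + y) v = act x v + act y v"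
    and act_mult: "v \<in> V \<Longrightarrow> act (x * y) v = act x (act y v)"
    and act_one: "v \<in> V \<Longrightarrow> act 1 v = v"

definition submodule_of ::
  "('r::complex_alg \<Rightarrow> 'v::ab_group_add \<Rightarrow> 'v) \<Rightarrow> 'v set \<Rightarrow> 'v set \<Rightarrow> bool" where
  "submodule_of act W V \<longleftrightarrow> W \<subseteq> V \<and> alg_module act W"

definition irreducible_module ::
  "('r::complex_alg \<Rightarrow> 'v::ab_group_add \<Rightarrow> 'v) \<Rightarrow> 'v set \<Rightarrow> bool" where
  "irreducible_module act V \<longleftrightarrow>
     alg_module act V \<and> V \<noteq> {0} \<and> (\<forall>W. submodule_of act W V \<longrightarrow> W = {0} \<or> W = V)"

definition module_isomorphic ::
  "('r::complex_alg \<Rightarrow> 'v::ab_group_add \<Rightarrow> 'v) \<Rightarrow> 'v set \<Rightarrow>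
   ('r \<Rightarrow> 'w::ab_group_add \<Rightarrow> 'w) \<Rightarrow> 'w set \<Rightarrow> bool" where
  "module_isomorphic act V act' W \<longleftrightarrow>
     (\<exists>\<phi>. bij_betw \<phi> V W \<and> (\<forall>u\<in>V. \<forall>v\<in>V. \<phi> (u + v) = \<phi> u + \<phi> v) \<and>
          (\<forall>x. \<forall>v\<in>V. \<phi> (act x v) = act' x (\<phi> v)))"

definition is_direct_sum ::
  "('r::complex_alg \<Rightarrow> 'v::ab_group_add \<Rightarrow> 'v) \<Rightarrow> 'v set \<Rightarrow> 'v set \<Rightarrow> 'v set \<Rightarrow> bool" where
  "is_direct_sum act V W1 W2 \<longleftrightarrow>
     submodule_of act W1 V \<and> submodule_of act W2 V \<and>
     V = {w1 + w2 | w1 w2. w1 \<in> W1 \<and> w2 \<in> W2} \<and> W1 \<inter> W2 = {0}"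


section \<open>The modules \<open>L\<^sub>n\<close>\<close>

text \<open>
  Vectors are formal complex combinations of \<open>v\<^sub>0, v\<^sub>1, \<dots>\<close>, where \<open>v\<^sub>i\<close> is \<open>basis_vec i\<close>, and
  \<open>L n\<close> is the span of \<open>v\<^sub>0, \<dots>, v\<^sub>n\<close>. The operators below are extended by \<open>0\<close> to the \<open>v\<^sub>i\<close>
  with \<open>i > n\<close>.
\<close>

type_synonym cvec = "nat \<Rightarrow>\<^sub>0 complex"

definition vscale :: "complex \<Rightarrow> cvec \<Rightarrow> cvec" where
  "vscale c v = Poly_Mapping.map ((*) c) v"

definition basis_vec :: "nat \<Rightarrow> cvec" where
  "basis_vec i = Poly_Mapping.single i 1"

definition L :: "nat \<Rightarrow> cvec set" where
  "L n = {v. Poly_Mapping.keys v \<subseteq> {0..n}}"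

lemma lookup_vscale [simp]: "Poly_Mapping.lookup (vscale c v) i = c * Poly_Mapping.lookup v i"
  by (simp add: vscale_def map.rep_eq when_def)

lemma vscale_simps [simp]:
  "vscale c (u + v) = vscale c u + vscale c v"
  "vscale (c + d) v = vscale c v + vscale d v"
  "vscale c (vscale d v) = vscale (c * d) v"
  "vscale 1 v = v" "vscale 0 v = 0" "vscale c 0 = 0"
  "vscale c (- v) = - vscale c v" "vscale c (u - v) = vscale c u - vscale c v"
  by (auto intro!: poly_mapping_eqI simp: lookup_add lookup_minus algebra_simps)

typedef lin_op = "{f :: cvec \<Rightarrow> cvec.
    (\<forall>u v. f (u + v) = f u + f v) \<and> (\<forall>c v. f (vscale c v) = vscale c (f v))}"
  by (rule exI[of _ id]) simp

setup_lifting type_definition_lin_op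

instantiation lin_op :: complex_alg
begin

lift_definition zero_lin_op :: lin_op is "\<lambda>_. 0" by simp
lift_definition one_lin_op :: lin_op is "\<lambda>v. v" by simp
lift_definition plus_lin_op :: "lin_op \<Rightarrow> lin_op \<Rightarrow> lin_op" is "\<lambda>f g v. f v + g v"
  by (simp add: algebra_simps)
lift_definition uminus_lin_op :: "lin_op \<Rightarrow> lin_op" is "\<lambda>f v. - f v"
  by simp
lift_definition minus_lin_op :: "lin_op \<Rightarrow> lin_op \<Rightarrow> lin_op" is "\<lambda>f g v. f v - g v"
  by (simp add: algebra_simps)
lift_definition times_lin_op :: "lin_op \<Rightarrow> lin_op \<Rightarrow> lin_op" is "\<lambda>f g v. f (g v)"
  by simp
lift_definition cscale_lin_op :: "complex \<Rightarrow> lin_op \<Rightarrow> lin_op" is "\<lambda>c f v. vscale c (f v)"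
  by (simp add: mult.commute)

instance
proof
  show "(0::lin_op) \<noteq> 1"
  proof
    assume "(0::lin_op) = 1"
    then have "Rep_lin_op 0 (basis_vec 0) = Rep_lin_op 1 (basis_vec 0)" by simp
    then show False
      by (simp add: zero_lin_op.rep_eq one_lin_op.rep_eq basis_vec_def poly_mapping_eq_iff
          fun_eq_iff lookup_single lookup_one when_def)
         (drule spec[of _ 0], simp)
  qed
qed (transfer, simp add: fun_eq_iff algebra_simps)+

end

lift_definition lin_extend :: "(nat \<Rightarrow> cvec) \<Rightarrow> lin_op" is
  "\<lambda>b v. \<Sum>i\<in>Poly_Mapping.keys v. vscale (Poly_Mapping.lookup v i) (b i)"
proof -
  fix b :: "nat \<Rightarrow> cvec"
  let ?f = "\<lambda>v. \<Sum>i\<in>Poly_Mapping.keys v. vscale (Poly_Mapping.lookup v i) (b i)"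
  have sup: "?f v = (\<Sum>i\<in>K. vscale (Poly_Mapping.lookup v i) (b i))"
    if "finite K" "Poly_Mapping.keys v \<subseteq> K" for v K
    by (rule sum.mono_neutral_left) (use that in \<open>auto simp: in_keys_iff\<close>)
  have add: "?f (u + v) = ?f u + ?f v" for u v
  proof -
    let ?K = "Poly_Mapping.keys u \<union> Poly_Mapping.keys v"
    have "Poly_Mapping.keys (u + v) \<subseteq> ?K" by (rule Poly_Mapping.keys_add)
    then show ?thesis
      using sup[of ?K "u + v"] sup[of ?K u] sup[of ?K v]
      by (simp add: lookup_add sum.distrib)
  qed
  have vscale_sum: "vscale c (sum g A) = (\<Sum>i\<in>A. vscale c (g i))" for c g and A :: "nat set"
    by (induction A rule: infinite_finite_induct) auto
  have "Poly_Mapping.keys (vscale c v) \<subseteq> Poly_Mapping.keys v" for c v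
    by (auto simp: in_keys_iff)
  then have "?f (vscale c v) = vscale c (?f v)" for c v
    using sup[of "Poly_Mapping.keys v" "vscale c v"] by (simp add: vscale_sum)
  with add show "(\<forall>u v. ?f (u + v) = ?f u + ?f v) \<and> (\<forall>c v. ?f (vscale c v) = vscale c (?f v))"
    by blast
qed

primrec L_gen :: "nat \<Rightarrow> sl2_gen \<Rightarrow> lin_op" where
  "L_gen n E_gen = lin_extend (\<lambda>i.
     if 1 \<le> i \<and> i \<le> n then vscale (of_nat n - of_nat i + 1) (basis_vec (i - 1)) else 0)"
| "L_gen n F_gen = lin_extend (\<lambda>i.
     if i < n then vscale (of_nat i + 1) (basis_vec (i + 1)) else 0)"
| "L_gen n H_gen = lin_extend (\<lambda>i.
     if i \<le> n then vscale (of_nat n - 2 * of_nat i) (basis_vec i) else 0)"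

definition L_act :: "nat \<Rightarrow> usl2 \<Rightarrow> cvec \<Rightarrow> cvec" where
  "L_act n x v = Rep_lin_op (palg_lift (L_gen n) x) v"

text \<open>The action of the universal Hahn algebra on \<open>L n\<close>, pulled back along \<open>natural\<close>.\<close>

definition L_hahn_act :: "nat \<Rightarrow> hahn \<Rightarrow> cvec \<Rightarrow> cvec" where
  "L_hahn_act n x v = L_act n (natural x) v"

lemma lin_op_simps:
  "Rep_lin_op f (u + v) = Rep_lin_op f u + Rep_lin_op f v"
  "Rep_lin_op f (vscale c v) = vscale c (Rep_lin_op f v)"
  using Rep_lin_op[of f] by auto

lemma lin_op_zero: "Rep_lin_op f 0 = 0"
  using lin_op_simps(1)[of f 0 0] by simp

lemma lin_extend_basis [simp]: "Rep_lin_op (lin_extend b) (basis_vec i) = b i"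
  by (simp add: lin_extend.rep_eq basis_vec_def)

lemma cvec_induct [case_names zero add]:
  assumes "P 0" "\<And>i c v. P v \<Longrightarrow> i \<in> Poly_Mapping.keys w \<Longrightarrow> P (vscale c (basis_vec i) + v)"
  shows "P (w :: cvec)"
proof -
  have w: "w = (\<Sum>i\<in>Poly_Mapping.keys w. vscale (Poly_Mapping.lookup w i) (basis_vec i))"
    by (rule poly_mapping_eqI)
       (auto simp: lookup_sum basis_vec_def lookup_single when_def in_keys_iff
         if_distrib cong: if_cong)
  have "P (\<Sum>i\<in>I. vscale (Poly_Mapping.lookup w i) (basis_vec i))"
    if "finite I" "I \<subseteq> Poly_Mapping.keys w" for I
    using that by (induction I rule: finite_induct) (auto intro: assms)
  then show ?thesis using w by (metis finite_keys order_refl)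
qed

lemma lin_op_eqI:
  assumes "\<And>i. Rep_lin_op f (basis_vec i) = Rep_lin_op g (basis_vec i)"
  shows "f = g"
proof -
  have "Rep_lin_op f v = Rep_lin_op g v" for v
    by (induction v rule: cvec_induct) (simp_all add: lin_op_simps lin_op_zero assms)
  then show ?thesis by (simp add: fun_eq_iff flip: Rep_lin_op_inject)
qed

lemma L_gen_relators:
  assumes "r \<in> relators"
  shows "free_eval (L_gen n) r = 0"
proof -
  note rep = zero_lin_op.rep_eq plus_lin_op.rep_eq minus_lin_op.rep_eq times_lin_op.rep_eq
    cscale_lin_op.rep_eq uminus_lin_op.rep_eq
  have "L_gen n H_gen * L_gen n E_gen - L_gen n E_gen * L_gen n H_gen - 2 * L_gen n E_gen = 0"
  proof (rule lin_op_eqI)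
    fix i
    show "Rep_lin_op (L_gen n H_gen * L_gen n E_gen - L_gen n E_gen * L_gen n H_gen
        - 2 * L_gen n E_gen) (basis_vec i) = Rep_lin_op 0 (basis_vec i)"
      by (rule poly_mapping_eqI, cases i)
         (auto simp: rep lin_op_simps lin_op_zero lookup_minus lookup_add of_nat_diff algebra_simps
           simp flip: cscale_numeral[where 'a = lin_op])
  qed
  moreover have
    "L_gen n H_gen * L_gen n F_gen - L_gen n F_gen * L_gen n H_gen + 2 * L_gen n F_gen = 0"
  proof (rule lin_op_eqI)
    fix i
    show "Rep_lin_op (L_gen n H_gen * L_gen n F_gen - L_gen n F_gen * L_gen n H_gen
        + 2 * L_gen n F_gen) (basis_vec i) = Rep_lin_op 0 (basis_vec i)"
      by (rule poly_mapping_eqI, cases "i < n"; cases "i = n")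
         (auto simp: rep lin_op_simps lin_op_zero lookup_minus lookup_add of_nat_diff algebra_simps
           simp flip: cscale_numeral[where 'a = lin_op])
  qed
  moreover have
    "L_gen n E_gen * L_gen n F_gen - L_gen n F_gen * L_gen n E_gen - L_gen n H_gen = 0"
  proof (rule lin_op_eqI)
    fix i
    show "Rep_lin_op (L_gen n E_gen * L_gen n F_gen - L_gen n F_gen * L_gen n E_gen
        - L_gen n H_gen) (basis_vec i) = Rep_lin_op 0 (basis_vec i)"
      by (rule poly_mapping_eqI, cases i; cases "i < n"; cases "i = n")
         (auto simp: rep lin_op_simps lin_op_zero lookup_minus lookup_add of_nat_diff algebra_simps)
  qed
  ultimately have *:
    "L_gen n H_gen * L_gen n E_gen - L_gen n E_gen * L_gen n H_gen - 2 * L_gen n E_gen = 0"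
    "L_gen n H_gen * L_gen n F_gen - L_gen n F_gen * L_gen n H_gen + 2 * L_gen n F_gen = 0"
    "L_gen n E_gen * L_gen n F_gen - L_gen n F_gen * L_gen n E_gen - L_gen n H_gen = 0"
    by blast+
  then show ?thesis
    using assms
    by (auto simp: relators_sl2_gen_def Let_def free_eval_simps commutator_def
        simp del: L_gen.simps)
qed

lemma L_act_alg_hom:
  "L_act n (x + y) v = L_act n x v + L_act n y v"
  "L_act n (x * y) v = L_act n x (L_act n y v)"
  "L_act n 1 v = v"
  "L_act n (c *\<^sub>C x) v = vscale c (L_act n x v)"
  "L_act n x (u + v) = L_act n x u + L_act n x v"
  "L_act n x (vscale c v) = vscale c (L_act n x v)"
proof -
  have "alg_hom (palg_lift (L_gen n))"
    by (rule alg_hom_palg_lift) (rule L_gen_relators)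
  then show "L_act n (x + y) v = L_act n x v + L_act n y v"
    "L_act n (x * y) v = L_act n x (L_act n y v)"
    "L_act n 1 v = v"
    "L_act n (c *\<^sub>C x) v = vscale c (L_act n x v)"
    by (simp_all add: L_act_def alg_hom_def plus_lin_op.rep_eq times_lin_op.rep_eq
        one_lin_op.rep_eq cscale_lin_op.rep_eq)
qed (simp_all add: L_act_def lin_op_simps)

lemma L_act_gen: "L_act n (palg_gen g) v = Rep_lin_op (L_gen n g) v"
  by (simp add: L_act_def palg_lift_gen L_gen_relators)

lemma L_act_basis:
  "1 \<le> i \<Longrightarrow> i \<le> n \<Longrightarrow> L_act n U_E (basis_vec i) = vscale (of_nat n - of_nat i + 1) (basis_vec (i - 1))"
  "L_act n U_E (basis_vec 0) = 0"
  "i < n \<Longrightarrow> L_act n U_F (basis_vec i) = vscale (of_nat i + 1) (basis_vec (i + 1))"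
  "L_act n U_F (basis_vec n) = 0"
  "i \<le> n \<Longrightarrow> L_act n U_H (basis_vec i) = vscale (of_nat n - 2 * of_nat i) (basis_vec i)"
  by (simp_all add: L_act_gen U_E_def U_F_def U_H_def del: vscale_simps)

lemma basis_vec_in_L: "i \<le> n \<Longrightarrow> basis_vec i \<in> L n"
  by (simp add: L_def basis_vec_def)

lemma L_closed: "0 \<in> L n" "u \<in> L n \<Longrightarrow> v \<in> L n \<Longrightarrow> u + v \<in> L n" "v \<in> L n \<Longrightarrow> vscale c v \<in> L n"
  using Poly_Mapping.keys_add[of u v] by (auto simp: L_def in_keys_iff)

lemma L_gen_closed:
  assumes "v \<in> L n"
  shows "Rep_lin_op (L_gen n g) v \<in> L n"
proof -
  have basis: "Rep_lin_op (L_gen n g) (basis_vec i) \<in> L n" if "i \<le> n" for i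
    by (cases g) (use that in \<open>auto intro!: L_closed basis_vec_in_L\<close>)
  have "i \<le> n" if "i \<in> Poly_Mapping.keys v" for i using that assms by (auto simp: L_def)
  then show ?thesis
    by (intro cvec_induct[of "\<lambda>u. Rep_lin_op (L_gen n g) u \<in> L n" v])
       (auto simp: lin_op_simps lin_op_zero intro!: L_closed basis simp del: L_gen.simps)
qed

lemma alg_module_L: "alg_module (L_act n) (L n)"
proof
  show "L_act n x v \<in> L n" if "v \<in> L n" for x v
  proof (induct x rule: palg.abs_induct)
    case (1 p)
    have "Rep_lin_op (free_eval (L_gen n) p) v \<in> L n"
    proof (induction p rule: free_alg_induct)
      case zero
      then show ?case by (simp add: zero_lin_op.rep_eq L_closed)
    next
      case (add w c p)
      have "Rep_lin_op (prod_list (map (L_gen n) w)) v \<in> L n"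
        using that
        by (induction w) (simp_all add: one_lin_op.rep_eq times_lin_op.rep_eq L_gen_closed)
      with add show ?case
        by (simp add: free_eval_add free_eval_single plus_lin_op.rep_eq cscale_lin_op.rep_eq
            L_closed)
    qed
    then show ?case by (simp add: L_act_def palg_lift_abs L_gen_relators)
  qed
qed (simp_all add: L_closed L_act_alg_hom)

lemma alg_module_L_hahn: "alg_module (L_hahn_act n) (L n)"
proof -
  interpret alg_module "L_act n" "L n" by (rule alg_module_L)
  show ?thesis
    using alg_hom_natural
    by unfold_locales (simp_all add: L_hahn_act_def alg_hom_def L_act_alg_hom L_closed act_closed)
qed

end

theory Submission
  imports Defs
begin

text \<open>
  On \<open>L n\<close> the generator \<open>A\<close> acts as \<open>H/4\<close>, which is diagonal in the basis \<open>v\<^sub>i\<close> with pairwise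
  distinct eigenvalues \<open>(n - 2 i)/4\<close>, while \<open>B\<close> and \<open>C\<close> involve \<open>E\<close> and \<open>F\<close> only through products
  of two of them. Since \<open>E\<close> and \<open>F\<close> each flip the parity of the index, the span of the
  \<open>v\<^sub>i\<close> with \<open>i\<close> even and the span of those with \<open>i\<close> odd are stable under the Hahn algebra, and
  \<open>L n\<close> is their direct sum.

  Each of the two parts is irreducible. As \<open>A\<close> has simple spectrum, a submodule contains every
  \<open>v\<^sub>i\<close> that occurs in one of its elements (\<open>basis_vec_in_submodule\<close>). As \<open>C\<close> acts as
  \<open>(E\<^sup>2 - F\<^sup>2)/4\<close>, both \<open>v\<^bsub>i-2\<^esub>\<close> and \<open>v\<^bsub>i+2\<^esub>\<close>, when they exist, occur in \<open>C v\<^sub>i\<close>; hence a submodule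
  containing one \<open>v\<^sub>i\<close> contains all those of the same parity.

  The two parts are not isomorphic because \<open>A\<close> has the eigenvalue \<open>n/4\<close> on the even part, with
  eigenvector \<open>v\<^sub>0\<close>, but not on the odd part. For \<open>n = 0\<close> the even part is everything.
\<close>

section \<open>The action in coordinates\<close>

lemma lookup_basis_vec: "Poly_Mapping.lookup (basis_vec i) j = (if i = j then 1 else 0)"
  by (simp add: basis_vec_def lookup_single when_def)

lemma basis_vec_nonzero: "basis_vec i \<noteq> 0"
  using lookup_basis_vec[of i i] by auto

lemma lookup_L_act_E:
  "Poly_Mapping.lookup (L_act n U_E v) j =
     (if j < n then (of_nat n - of_nat j) * Poly_Mapping.lookup v (Suc j) else 0)"
proof (induction v rule: cvec_induct)
  case zero
  then show ?case by (simp add: L_act_gen U_E_def lin_op_zero)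
next
  case (add i c v)
  have "Poly_Mapping.lookup (L_act n U_E (basis_vec i)) j =
      (if j < n then (of_nat n - of_nat j) * Poly_Mapping.lookup (basis_vec i) (Suc j) else 0)"
    by (cases i) (auto simp: L_act_gen U_E_def lookup_basis_vec lookup_add)
  then show ?case
    using add by (simp add: L_act_alg_hom lookup_add algebra_simps)
qed

lemma lookup_L_act_F:
  "Poly_Mapping.lookup (L_act n U_F v) j =
     (if 1 \<le> j \<and> j \<le> n then of_nat j * Poly_Mapping.lookup v (j - 1) else 0)"
proof (induction v rule: cvec_induct)
  case zero
  then show ?case by (simp add: L_act_gen U_F_def lin_op_zero)
next
  case (add i c v)
  have "Poly_Mapping.lookup (L_act n U_F (basis_vec i)) j =
      (if 1 \<le> j \<and> j \<le> n then of_nat j * Poly_Mapping.lookup (basis_vec i) (j - 1) else 0)"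
    by (cases j) (auto simp: L_act_gen U_F_def lookup_basis_vec lookup_add)
  then show ?case
    using add by (simp add: L_act_alg_hom lookup_add algebra_simps)
qed

lemma lookup_L_act_H:
  "Poly_Mapping.lookup (L_act n U_H v) j =
     (if j \<le> n then (of_nat n - 2 * of_nat j) * Poly_Mapping.lookup v j else 0)"
proof (induction v rule: cvec_induct)
  case zero
  then show ?case by (simp add: L_act_gen U_H_def lin_op_zero)
next
  case (add i c v)
  have "Poly_Mapping.lookup (L_act n U_H (basis_vec i)) j =
      (if j \<le> n then (of_nat n - 2 * of_nat j) * Poly_Mapping.lookup (basis_vec i) j else 0)"
    by (auto simp: L_act_gen U_H_def lookup_basis_vec)
  then show ?case
    using add by (simp add: L_act_alg_hom lookup_add algebra_simps)
qed

lemma L_act_diff: "L_act n (x - y) v = L_act n x v - L_act n y v"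
  using L_act_alg_hom(1)[of n "x - y" y v] by (simp add: algebra_simps)

lemma L_hahn_act_A: "L_hahn_act n hahn_A v = vscale (1/4) (L_act n U_H v)"
  by (simp add: L_hahn_act_def natural_hahn L_act_alg_hom)

lemma L_hahn_act_C:
  "L_hahn_act n hahn_C v =
     vscale (1/4) (L_act n U_E (L_act n U_E v) - L_act n U_F (L_act n U_F v))"
  by (simp add: L_hahn_act_def natural_hahn L_act_alg_hom L_act_diff power2_eq_square)

lemma L_hahn_act_scalar: "L_hahn_act n (c *\<^sub>C 1) v = vscale c v"
  using alg_hom_natural by (simp add: L_hahn_act_def alg_hom_def L_act_alg_hom)


section \<open>The parity subspaces\<close>

definition L_parity :: "nat \<Rightarrow> bool \<Rightarrow> cvec set" where
  "L_parity n b = {v. \<forall>i\<in>Poly_Mapping.keys v. i \<le> n \<and> even i = b}"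

lemma L_parity_iff:
  "v \<in> L_parity n b \<longleftrightarrow> (\<forall>i. Poly_Mapping.lookup v i \<noteq> 0 \<longrightarrow> i \<le> n \<and> even i = b)"
  by (simp only: L_parity_def in_keys_iff Ball_def mem_Collect_eq)

lemma L_parity_subset: "L_parity n b \<subseteq> L n"
  by (auto simp: L_parity_def L_def)

lemma L_parity_closed:
  "0 \<in> L_parity n b"
  "u \<in> L_parity n b \<Longrightarrow> v \<in> L_parity n b \<Longrightarrow> u + v \<in> L_parity n b"
  "u \<in> L_parity n b \<Longrightarrow> v \<in> L_parity n b \<Longrightarrow> u - v \<in> L_parity n b"
  "v \<in> L_parity n b \<Longrightarrow> vscale c v \<in> L_parity n b"
  unfolding L_parity_iff lookup_add lookup_minus lookup_vscale lookup_zero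
  by (metis add_0 diff_0_right mult_zero_right)+

lemma basis_vec_in_L_parity: "i \<le> n \<Longrightarrow> even i = b \<Longrightarrow> basis_vec i \<in> L_parity n b"
  by (simp add: L_parity_def basis_vec_def)

lemma L_act_parity:
  "v \<in> L_parity n b \<Longrightarrow> L_act n U_E v \<in> L_parity n (\<not> b)"
  "v \<in> L_parity n b \<Longrightarrow> L_act n U_F v \<in> L_parity n (\<not> b)"
  "v \<in> L_parity n b \<Longrightarrow> L_act n U_H v \<in> L_parity n b"
  by (fastforce simp: L_parity_iff lookup_L_act_E lookup_L_act_F lookup_L_act_H
      split: if_splits)+

text \<open>
  In \<open>natural_gen\<close> the parity-reversing \<open>E\<close> and \<open>F\<close> occur only in the products \<open>E\<^sup>2\<close>, \<open>F\<^sup>2\<close>,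
  \<open>EF\<close> and \<open>FE\<close>.
\<close>

lemma natural_gen_parity:
  assumes "v \<in> L_parity n b"
  shows "L_act n (natural_gen g) v \<in> L_parity n b"
proof -
  have "L_act n U_E (L_act n U_E v) \<in> L_parity n b" "L_act n U_F (L_act n U_F v) \<in> L_parity n b"
    "L_act n U_E (L_act n U_F v) \<in> L_parity n b" "L_act n U_F (L_act n U_E v) \<in> L_parity n b"
    "L_act n U_H v \<in> L_parity n b" "L_act n U_H (L_act n U_H v) \<in> L_parity n b"
    using L_act_parity[OF assms] L_act_parity(1,2)[of _ n "\<not> b"] L_act_parity(3)[of _ n b]
    by simp_all
  then show ?thesis
    using assms
    by (cases g) (auto simp: L_act_alg_hom L_act_diff casimir_def power2_eq_square
        simp del: vscale_simps intro!: L_parity_closed)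
qed

lemma alg_module_L_parity: "alg_module (L_hahn_act n) (L_parity n b)"
proof -
  interpret alg_module "L_hahn_act n" "L n" by (rule alg_module_L_hahn)
  have closed: "L_hahn_act n x v \<in> L_parity n b" if "v \<in> L_parity n b" for x v
  proof (induct x rule: palg.abs_induct)
    case (1 p)
    have "L_act n (free_eval natural_gen p) v \<in> L_parity n b"
    proof (induction p rule: free_alg_induct)
      case zero
      have "L_act n 0 v = 0" using L_act_alg_hom(1)[of n 0 0 v] by simp
      then show ?case by (simp add: L_parity_closed)
    next
      case (add w c p)
      have "L_act n (prod_list (map natural_gen w)) v \<in> L_parity n b"
        using that by (induction w) (simp_all add: L_act_alg_hom natural_gen_parity
            del: natural_gen.simps)
      with add show ?case
        by (simp add: free_eval_add free_eval_single L_act_alg_hom L_parity_closed)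
    qed
    then show ?case
      by (simp add: L_hahn_act_def natural_def palg_lift_abs natural_gen_relators)
  qed
  show ?thesis
    using L_parity_subset[of n b]
    by unfold_locales
       (auto simp: L_parity_closed closed act_add_right act_add_left act_mult act_one subset_iff)
qed

lemma direct_sum_L_parity:
  "is_direct_sum (L_hahn_act n) (L n) (L_parity n True) (L_parity n False)"
proof -
  have decompose: "\<exists>w1 w2. v = w1 + w2 \<and> w1 \<in> L_parity n True \<and> w2 \<in> L_parity n False" if "v \<in> L n" for v
  proof (rule cvec_induct)
    show "\<exists>w1 w2. 0 = w1 + w2 \<and> w1 \<in> L_parity n True \<and> w2 \<in> L_parity n False"
      by (metis L_parity_closed(1) add_0)
  next
    fix i c u
    assume "\<exists>w1 w2. u = w1 + w2 \<and> w1 \<in> L_parity n True \<and> w2 \<in> L_parity n False"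
    then obtain w1 w2 where u: "u = w1 + w2" "w1 \<in> L_parity n True" "w2 \<in> L_parity n False"
      by blast
    assume "i \<in> Poly_Mapping.keys v"
    then have "vscale c (basis_vec i) \<in> L_parity n (even i)"
      using that by (intro L_parity_closed basis_vec_in_L_parity) (auto simp: L_def)
    then show "\<exists>w1 w2. vscale c (basis_vec i) + u = w1 + w2 \<and>
        w1 \<in> L_parity n True \<and> w2 \<in> L_parity n False"
    proof (cases "even i")
      case True
      then show ?thesis
        using u \<open>vscale c (basis_vec i) \<in> _\<close> L_parity_closed(2)[of "vscale c (basis_vec i)" n True w1]
        by (intro exI[of _ "vscale c (basis_vec i) + w1"] exI[of _ w2]) (simp add: add.assoc)
    next
      case False
      then show ?thesis
        using u \<open>vscale c (basis_vec i) \<in> _\<close> L_parity_closed(2)[of "vscale c (basis_vec i)" n False w2]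
        by (intro exI[of _ w1] exI[of _ "vscale c (basis_vec i) + w2"]) (simp add: add.left_commute)
    qed
  qed
  have disjoint: "L_parity n True \<inter> L_parity n False = {0}"
    by (auto simp: L_parity_def)
  have sum: "w1 + w2 \<in> L n" if "w1 \<in> L_parity n True" "w2 \<in> L_parity n False" for w1 w2
    using that L_parity_subset by (blast intro: L_closed)
  have "L n = {w1 + w2 | w1 w2. w1 \<in> L_parity n True \<and> w2 \<in> L_parity n False}" (is "_ = ?S")
  proof
    show "L n \<subseteq> ?S" by (rule subsetI, rule CollectI, rule decompose)
    show "?S \<subseteq> L n" by (clarify, rule sum)
  qed
  then show ?thesis
    unfolding is_direct_sum_def submodule_of_def
    by (intro conjI L_parity_subset alg_module_L_parity disjoint)
qed


section \<open>Irreducibility of the parity subspaces\<close>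

text \<open>
  The operator \<open>4A - (n - 2k)\<close> annihilates the coordinate \<open>k\<close> of a vector and multiplies every other
  coordinate by a nonzero number, so all coordinates but one chosen \<open>i\<close> can be removed in turn.
\<close>

lemma basis_vec_in_submodule:
  assumes W: "alg_module (L_hahn_act n) W" "W \<subseteq> L n"
    and w: "w \<in> W" "i \<in> Poly_Mapping.keys w"
  shows "basis_vec i \<in> W"
  using w
proof (induction "card (Poly_Mapping.keys w)" arbitrary: w rule: less_induct)
  case less
  interpret alg_module "L_hahn_act n" W by (rule W(1))
  have scale: "vscale c u \<in> W" if "u \<in> W" for c u
    using act_closed[OF that, of "c *\<^sub>C 1"] by (simp only: L_hahn_act_scalar)
  have keys_le: "k \<le> n" if "k \<in> Poly_Mapping.keys w" for k
    using that less.prems(1) W(2) by (fastforce simp: L_def)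
  show ?case
  proof (cases "Poly_Mapping.keys w = {i}")
    case True
    then have "basis_vec i = vscale (1 / Poly_Mapping.lookup w i) w"
      using in_keys_iff[of _ w]
      by (intro poly_mapping_eqI) (simp add: lookup_basis_vec, metis)
    then show ?thesis using scale less.prems(1) by simp
  next
    case False
    then obtain k where k: "k \<in> Poly_Mapping.keys w" "k \<noteq> i"
      using less.prems(2) by blast
    define u where "u = L_hahn_act n hahn_A (vscale 4 w) + vscale (- (of_nat n - 2 * of_nat k)) w"
    have u: "Poly_Mapping.lookup u j = 2 * (of_nat k - of_nat j) * Poly_Mapping.lookup w j" for j
    proof (cases "j \<le> n")
      case True
      then show ?thesis
        by (simp add: u_def L_hahn_act_A lookup_add lookup_L_act_H algebra_simps
            del: vscale_simps)
    next
      case False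
      then have "Poly_Mapping.lookup w j = 0" using keys_le[of j] by (auto simp: in_keys_iff)
      then show ?thesis
        by (simp add: u_def L_hahn_act_A lookup_add lookup_L_act_H del: vscale_simps)
    qed
    have keys: "Poly_Mapping.keys u = Poly_Mapping.keys w - {k}"
      by (auto simp: in_keys_iff u)
    have "u \<in> W"
      unfolding u_def by (intro add_closed act_closed scale less.prems(1))
    moreover have "card (Poly_Mapping.keys u) < card (Poly_Mapping.keys w)"
      unfolding keys by (rule card_Diff1_less) (simp_all add: k)
    moreover have "i \<in> Poly_Mapping.keys u" using keys less.prems(2) k by auto
    ultimately show ?thesis using less.hyps by blast
  qed
qed

text \<open>
  \<open>C\<close> moves \<open>v\<^sub>i\<close> to a combination of \<open>v\<^bsub>i-2\<^esub>\<close> and \<open>v\<^bsub>i+2\<^esub>\<close> whose coefficients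
  \<open>(n - i + 1)(n - i + 2)/4\<close> and \<open>- (i + 1)(i + 2)/4\<close> are nonzero as long as the indices stay
  in \<open>{0..n}\<close>.
\<close>

lemma basis_vec_step:
  assumes W: "alg_module (L_hahn_act n) W" "W \<subseteq> L n"
  shows "basis_vec i \<in> W \<Longrightarrow> i + 2 \<le> n \<Longrightarrow> basis_vec (i + 2) \<in> W"
    and "basis_vec (i + 2) \<in> W \<Longrightarrow> i + 2 \<le> n \<Longrightarrow> basis_vec i \<in> W"
proof -
  interpret alg_module "L_hahn_act n" W by (rule W(1))
  assume i: "i + 2 \<le> n"
  have nz: "complex_of_nat i + 1 \<noteq> 0" "complex_of_nat i + 2 \<noteq> 0"
    using of_nat_0_neq[of i, where 'a=complex] of_nat_0_neq[of "Suc i", where 'a=complex]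
    by (simp_all add: add.commute)
  have nz': "complex_of_nat n - complex_of_nat i \<noteq> 0" "complex_of_nat n - (complex_of_nat i + 1) \<noteq> 0"
    using i of_nat_eq_iff[of n "i + 1", where 'a=complex] by auto
  show "basis_vec (i + 2) \<in> W" if "basis_vec i \<in> W"
  proof (rule basis_vec_in_submodule[OF W])
    show "L_hahn_act n hahn_C (basis_vec i) \<in> W" using that by (rule act_closed)
    show "i + 2 \<in> Poly_Mapping.keys (L_hahn_act n hahn_C (basis_vec i))"
      using i nz by (auto simp: in_keys_iff L_hahn_act_C lookup_minus lookup_L_act_E lookup_L_act_F
          lookup_basis_vec add.commute simp del: vscale_simps)
  qed
  show "basis_vec i \<in> W" if "basis_vec (i + 2) \<in> W"
  proof (rule basis_vec_in_submodule[OF W])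
    show "L_hahn_act n hahn_C (basis_vec (i + 2)) \<in> W" using that by (rule act_closed)
    show "i \<in> Poly_Mapping.keys (L_hahn_act n hahn_C (basis_vec (i + 2)))"
      using i nz' by (auto simp: in_keys_iff L_hahn_act_C lookup_minus lookup_L_act_E lookup_L_act_F
          lookup_basis_vec add.commute simp del: vscale_simps)
  qed
qed

lemma basis_vec_same_parity:
  assumes W: "alg_module (L_hahn_act n) W" "W \<subseteq> L n"
    and i: "basis_vec i \<in> W" "i \<le> n"
    and j: "j \<le> n" "even i = even j"
  shows "basis_vec j \<in> W"
proof -
  have down: "basis_vec (i mod 2) \<in> W" if "basis_vec i \<in> W" "i \<le> n" for i
    using that
  proof (induction i rule: nat_induct2)
    case (step i)
    then show ?case using basis_vec_step(2)[OF W, of i] by simp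
  qed simp_all
  have up: "basis_vec j \<in> W" if "basis_vec (j mod 2) \<in> W" "j \<le> n" for j
    using that
  proof (induction j rule: nat_induct2)
    case (step j)
    then show ?case using basis_vec_step(1)[OF W, of j] by simp
  qed simp_all
  have "i mod 2 = j mod 2" using j(2) by (simp add: mod2_eq_if)
  then show ?thesis using down[OF i] up[OF _ j(1)] by simp
qed

text \<open>
  The index \<open>i\<close> serves to exclude the odd part of \<open>L 0\<close>, which is zero and hence not irreducible.
\<close>

lemma irreducible_L_parity:
  assumes "i \<le> n" "even i = b"
  shows "irreducible_module (L_hahn_act n) (L_parity n b)"
  unfolding irreducible_module_def
proof (intro conjI allI impI)
  show "alg_module (L_hahn_act n) (L_parity n b)" by (rule alg_module_L_parity)
  show "L_parity n b \<noteq> {0}"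
    using basis_vec_in_L_parity[OF assms] basis_vec_nonzero by blast
next
  fix W
  assume "submodule_of (L_hahn_act n) W (L_parity n b)"
  then have sub: "W \<subseteq> L_parity n b" and W: "alg_module (L_hahn_act n) W" "W \<subseteq> L n"
    using L_parity_subset by (auto simp: submodule_of_def)
  interpret alg_module "L_hahn_act n" W by (rule W(1))
  show "W = {0} \<or> W = L_parity n b"
  proof (cases "W = {0}")
    case False
    then obtain w where w: "w \<in> W" "w \<noteq> 0" using zero_closed by blast
    then obtain k where "k \<in> Poly_Mapping.keys w" by (metis keys_eq_empty all_not_in_conv)
    with w(1) have k: "basis_vec k \<in> W" "k \<le> n" "even k = b"
      using basis_vec_in_submodule[OF W] sub by (auto simp: L_parity_def)
    have "v \<in> W" if "v \<in> L_parity n b" for v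
    proof (rule cvec_induct[of "\<lambda>v. v \<in> W"])
      fix j c u
      assume u: "u \<in> W" and "j \<in> Poly_Mapping.keys v"
      then have "basis_vec j \<in> W"
        using that by (intro basis_vec_same_parity[OF W k(1,2)]) (auto simp: L_parity_def k(3))
      then have "vscale c (basis_vec j) \<in> W"
        using act_closed[of "basis_vec j" "c *\<^sub>C 1"] by (simp only: L_hahn_act_scalar)
      then show "vscale c (basis_vec j) + u \<in> W" using u by (rule add_closed)
    qed (rule zero_closed)
    then show ?thesis using sub by blast
  qed simp
qed


section \<open>Non-isomorphism of the two parity subspaces\<close>

lemma not_isomorphic_L_parity:
  "\<not> module_isomorphic (L_hahn_act n) (L_parity n True) (L_hahn_act n) (L_parity n False)"
proof
  assume "module_isomorphic (L_hahn_act n) (L_parity n True) (L_hahn_act n) (L_parity n False)"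
  then obtain \<phi> where bij: "bij_betw \<phi> (L_parity n True) (L_parity n False)"
    and add: "\<And>u v. u \<in> L_parity n True \<Longrightarrow> v \<in> L_parity n True \<Longrightarrow> \<phi> (u + v) = \<phi> u + \<phi> v"
    and lin: "\<And>x v. v \<in> L_parity n True \<Longrightarrow> \<phi> (L_hahn_act n x v) = L_hahn_act n x (\<phi> v)"
    unfolding module_isomorphic_def by blast
  \<comment> \<open>An eigenvector of \<open>A\<close> for an eigenvalue that odd indices do not have.\<close>
  let ?v = "basis_vec 0"
  have v: "?v \<in> L_parity n True" by (rule basis_vec_in_L_parity) simp_all
  have "L_hahn_act n hahn_A ?v = L_hahn_act n ((of_nat n / 4) *\<^sub>C 1) ?v"
    by (rule poly_mapping_eqI)
       (simp add: L_hahn_act_A L_hahn_act_scalar lookup_L_act_H lookup_basis_vec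
         del: vscale_simps)
  then have eig: "L_hahn_act n hahn_A (\<phi> ?v) = vscale (of_nat n / 4) (\<phi> ?v)"
    using lin[OF v] L_hahn_act_scalar by metis
  have \<phi>v: "\<phi> ?v \<in> L_parity n False" using bij v by (auto simp: bij_betw_def)
  have "Poly_Mapping.lookup (\<phi> ?v) j = 0" for j
  proof (rule ccontr)
    assume nz: "Poly_Mapping.lookup (\<phi> ?v) j \<noteq> 0"
    then have j: "j \<le> n" "odd j" using \<phi>v by (auto simp: L_parity_iff)
    have "(of_nat n - 2 * of_nat j) / 4 * Poly_Mapping.lookup (\<phi> ?v) j =
        of_nat n / 4 * Poly_Mapping.lookup (\<phi> ?v) j"
      using arg_cong[OF eig, of "\<lambda>u. Poly_Mapping.lookup u j"] j(1)
      by (simp add: L_hahn_act_A lookup_L_act_H)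
    then have "j = 0" using nz by simp
    with j(2) show False by simp
  qed
  then have "\<phi> ?v = 0" by (intro poly_mapping_eqI) simp
  moreover have "\<phi> 0 = 0"
    using add[OF L_parity_closed(1) L_parity_closed(1)] by simp
  ultimately have "?v = 0"
    using bij v L_parity_closed(1) by (metis bij_betw_def inj_onD)
  then show False by (simp add: basis_vec_nonzero)
qed


section \<open>The decomposition of \<open>L n\<close>\<close>

theorem theorem1p7:
  shows "irreducible_module (L_hahn_act 0) (L 0) \<and>
    (\<forall>n\<ge>1. \<exists>W1 W2.
       is_direct_sum (L_hahn_act n) (L n) W1 W2 \<and>
       irreducible_module (L_hahn_act n) W1 \<and>
       irreducible_module (L_hahn_act n) W2 \<and>
       \<not> module_isomorphic (L_hahn_act n) W1 (L_hahn_act n) W2)"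
proof (intro conjI allI impI)
  have "L 0 = L_parity 0 True"
    by (auto simp: L_def L_parity_def)
  then show "irreducible_module (L_hahn_act 0) (L 0)"
    using irreducible_L_parity[of 0 0 True] by simp
next
  fix n :: nat
  assume "1 \<le> n"
  then show "\<exists>W1 W2.
       is_direct_sum (L_hahn_act n) (L n) W1 W2 \<and>
       irreducible_module (L_hahn_act n) W1 \<and>
       irreducible_module (L_hahn_act n) W2 \<and>
       \<not> module_isomorphic (L_hahn_act n) W1 (L_hahn_act n) W2"
    by (intro exI[of _ "L_parity n True"] exI[of _ "L_parity n False"] conjI
        direct_sum_L_parity not_isomorphic_L_parity
        irreducible_L_parity[of 0] irreducible_L_parity[of 1]) simp_all
qed

end
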